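(* Let $\mu\subseteq\lambda$ be partitions such that the skew diagram $\lambda/\mu$ has $n$ cells, and let $N\geq n$. Then \[ P_{\lambda/\mu}(x_1,\ldots,x_N;t)=\sum_{S^*\in\mathrm{SYT}^*(\lambda/\mu)} \operatorname{sgn}(S^* )\,t^{\operatorname{tstat}(S^* )}\,F_{\operatorname{Asc}'(S^* )}(x_1,\ldots,x_N). \]
   Context: $t$ is an indeterminate. For a partition $\lambda$ and $\mu\subseteq\lambda$, the skew diagram is $\lambda/\mu=\{(i,j):1\le i\le \ell(\lambda),\ \mu_i<j\le\lambda_i\}$ (matrix coordinates, English convention); $\mu/(0)$ denotes the diagram of $\mu$. A semistandard tableau of shape $\lambda/\mu$ with entries in $[N]$ is a map $T:\lambda/\mu\to[N]$ weakly increasing along rows and strictly increasing down columns; $x^T=\prod_{c}x_{T(c)}$. A standard tableau is a bijection $\lambda/\mu\to[n]$ that is semistandard. For such $T$, a cell $(i,j)$ is special if $j>1$ and no cell $(u,j-1)\in\lambda/\mu$ has $T((u,j-1))=T((i,j))$; its weight is $\mathrm{wt}((i,j))=|\{(u,j-1)\in\lambda/\mu: u\ge i,\ T((u,j-1))<T((i,j))\}|+|\{(u,j-1)\in\mu/(0):u\ge i\}|$. Let $\mathrm{spec}(T)$ be the set of special cells. The skew Hall–Littlewood polynomial is $P_{\lambda/\mu}(x_1,\dots,x_N;t)=\sum_T \prod_{c\in\mathrm{spec}(T)}(1-t^{\mathrm{wt}(c)})\,x^T$, summed over semistandard tableaux $T$ of shape $\lambda/\mu$ with entries in $[N]$ (Macdonald's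 formula). A starred standard tableau is a pair $S^*=(S,E)$ with $S$ a standard tableau of shape $\lambda/\mu$ and $E\subseteq\mathrm{spec}(S)$ (i.e. $E$ is any set of cells not in column 1); $\mathrm{SYT}^*(\lambda/\mu)$ is the set of these, $\operatorname{sgn}(S^* )=(-1)^{|E|}$, $\operatorname{tstat}(S^* )=\sum_{c\in E}\mathrm{wt}(c)$. The ascent set $\operatorname{Asc}(S^* )$ is the set of $k<n$ such that either (a) $k+1$ appears in $S$ in a lower row than $k$, or (b) there are $u,i,j$ with $S((u,j-1))=k$, $S((i,j))=k+1$ and $(i,j)\in E$. For $T=\{t_1<\dots<t_m\}\subseteq[n-1]$, $\mathrm{comp}(T)=(t_1,t_2-t_1,\ldots,n-t_m)$, and $\operatorname{Asc}'(S^* )=\mathrm{comp}(\operatorname{Asc}(S^* ))$. For a composition $\alpha$ of $n$ with $\mathrm{sub}(\alpha)=\{\alpha_1,\alpha_1+\alpha_2,\ldots,\alpha_1+\dots+\alpha_{\ell-1}\}$, the fundamental quasisymmetric polynomial is $F_\alpha(x_1,\ldots,x_N)=\sum x_{w_1}\cdots x_{w_n}$ over $1\le w_1\le\dots\le w_n\le N$ with $w_j<w_{j+1}$ for all $j\in\mathrm{sub}(\alpha)$. *)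

theory Defs
  imports
    "HOL-Library.Poly_Mapping"
    "HOL-Library.FuncSet"
    "HOL-Computational_Algebra.Polynomial"
begin

text \<open>
  A polynomial in variables indexed by the naturals, with coefficients in \<open>\<int>[t]\<close>, is a finitely
  supported map from monomials (exponent vectors) to \<open>int poly\<close>; the indeterminate of
  \<open>int poly\<close> plays the role of \<open>t\<close>.
\<close>

type_synonym mpol = "(nat \<Rightarrow>\<^sub>0 nat) \<Rightarrow>\<^sub>0 int poly"

definition xvar :: "nat \<Rightarrow> mpol" where
  "xvar i = Poly_Mapping.single (Poly_Mapping.single i 1) 1"

definition tvar :: mpol where
  "tvar = Poly_Mapping.single 0 [:0, 1:]"

definition is_partition :: "nat list \<Rightarrow> bool" where
  "is_partition lam \<longleftrightarrow> sorted_wrt (\<ge>) lam \<and> 0 \<notin> set lam"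

text \<open>Parts are numbered from 1, and \<open>lam\<^sub>i = 0\<close> beyond the length.\<close>

definition part :: "nat list \<Rightarrow> nat \<Rightarrow> nat" where
  "part lam i = (if 1 \<le> i \<and> i \<le> length lam then lam ! (i - 1) else 0)"

definition part_contained :: "nat list \<Rightarrow> nat list \<Rightarrow> bool" where
  "part_contained mu lam \<longleftrightarrow> (\<forall>i. part mu i \<le> part lam i)"

type_synonym cell = "nat \<times> nat"
type_synonym tableau = "cell \<Rightarrow> nat"

definition skew_diagram :: "nat list \<Rightarrow> nat list \<Rightarrow> cell set" where
  "skew_diagram lam mu = {(i, j). 1 \<le> i \<and> i \<le> length lam \<and> part mu i < j \<and> j \<le> part lam i}"

text \<open>Tableaux are extensional functions, so that each is counted exactly once.\<close>

definition SSYT :: "nat list \<Rightarrow> nat list \<Rightarrow> nat \<Rightarrow> tableau set" where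
  "SSYT lam mu N = {T \<in> skew_diagram lam mu \<rightarrow>\<^sub>E {1..N}.
     (\<forall>i j j'. (i, j) \<in> skew_diagram lam mu \<longrightarrow> (i, j') \<in> skew_diagram lam mu \<longrightarrow> j < j'
        \<longrightarrow> T (i, j) \<le> T (i, j')) \<and>
     (\<forall>i i' j. (i, j) \<in> skew_diagram lam mu \<longrightarrow> (i', j) \<in> skew_diagram lam mu \<longrightarrow> i < i'
        \<longrightarrow> T (i, j) < T (i', j))}"

definition SYT :: "nat list \<Rightarrow> nat list \<Rightarrow> tableau set" where
  "SYT lam mu = {S \<in> SSYT lam mu (card (skew_diagram lam mu)).
     bij_betw S (skew_diagram lam mu) {1..card (skew_diagram lam mu)}}"

definition spec :: "nat list \<Rightarrow> nat list \<Rightarrow> tableau \<Rightarrow> cell set" where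
  "spec lam mu T = {(i, j) \<in> skew_diagram lam mu.
     j > 1 \<and> \<not> (\<exists>u. (u, j - 1) \<in> skew_diagram lam mu \<and> T (u, j - 1) = T (i, j))}"

definition wt :: "nat list \<Rightarrow> nat list \<Rightarrow> tableau \<Rightarrow> cell \<Rightarrow> nat" where
  "wt lam mu T = (\<lambda>(i, j).
     card {(u, v) \<in> skew_diagram lam mu. v = j - 1 \<and> u \<ge> i \<and> T (u, v) < T (i, j)}
     + card {(u, v) \<in> skew_diagram mu []. v = j - 1 \<and> u \<ge> i})"

definition skew_HL_poly :: "nat list \<Rightarrow> nat list \<Rightarrow> nat \<Rightarrow> mpol" where
  "skew_HL_poly lam mu N = (\<Sum>T\<in>SSYT lam mu N.
     (\<Prod>c\<in>spec lam mu T. 1 - tvar ^ wt lam mu T c) * (\<Prod>c\<in>skew_diagram lam mu. xvar (T c)))"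

type_synonym starred_tableau = "tableau \<times> cell set"

definition SYT_star :: "nat list \<Rightarrow> nat list \<Rightarrow> starred_tableau set" where
  "SYT_star lam mu = {(S, E). S \<in> SYT lam mu \<and> E \<subseteq> spec lam mu S}"

definition star_sgn :: "starred_tableau \<Rightarrow> mpol" where
  "star_sgn = (\<lambda>(S, E). (- 1) ^ card E)"

definition tstat :: "nat list \<Rightarrow> nat list \<Rightarrow> starred_tableau \<Rightarrow> nat" where
  "tstat lam mu = (\<lambda>(S, E). \<Sum>c\<in>E. wt lam mu S c)"

text \<open>Rows are numbered downwards, so a lower row has a larger index.\<close>

definition Asc :: "nat list \<Rightarrow> nat list \<Rightarrow> starred_tableau \<Rightarrow> nat set" where
  "Asc lam mu = (\<lambda>(S, E). {k. 1 \<le> k \<and> k < card (skew_diagram lam mu) \<and>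
     ((\<exists>i j i' j'. (i, j) \<in> skew_diagram lam mu \<and> (i', j') \<in> skew_diagram lam mu \<and>
          S (i, j) = k \<and> S (i', j') = k + 1 \<and> i < i') \<or>
      (\<exists>u i j. (u, j - 1) \<in> skew_diagram lam mu \<and> (i, j) \<in> skew_diagram lam mu \<and>
          S (u, j - 1) = k \<and> S (i, j) = k + 1 \<and> (i, j) \<in> E))})"

text \<open>
  \<open>comp_of_set n {t\<^sub>1 < \<dots> < t\<^sub>m} = [t\<^sub>1, t\<^sub>2 - t\<^sub>1, \<dots>, n - t\<^sub>m]\<close>; for \<open>n = 0\<close> it is the empty composition.
\<close>

definition comp_of_set :: "nat \<Rightarrow> nat set \<Rightarrow> nat list" where
  "comp_of_set n A = (if n = 0 then [] else
     (let ts = sorted_list_of_set A in map2 (-) (ts @ [n]) (0 # ts)))"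

definition Asc_comp :: "nat list \<Rightarrow> nat list \<Rightarrow> starred_tableau \<Rightarrow> nat list" where
  "Asc_comp lam mu S = comp_of_set (card (skew_diagram lam mu)) (Asc lam mu S)"

definition sub_of_comp :: "nat list \<Rightarrow> nat set" where
  "sub_of_comp \<alpha> = {sum_list (take i \<alpha>) | i. 1 \<le> i \<and> i < length \<alpha>}"

definition fundamental_qsym :: "nat \<Rightarrow> nat list \<Rightarrow> mpol" where
  "fundamental_qsym N \<alpha> =
     (\<Sum>w | w \<in> {1..sum_list \<alpha>} \<rightarrow>\<^sub>E {1..N} \<and> mono_on {1..sum_list \<alpha>} w \<and>
            (\<forall>j\<in>sub_of_comp \<alpha>. w j < w (j + 1)).
        \<Prod>j\<in>{1..sum_list \<alpha>}. xvar (w j))"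

end

theory Submission
  imports Defs "HOL-Library.Product_Lexorder"
begin

text \<open>
  Expanding the product over special cells turns the left-hand side into a signed sum over pairs
  \<open>(T, E)\<close> with \<open>E \<subseteq> spec(T)\<close>. Such pairs correspond to triples \<open>(S, E, w)\<close>, where \<open>(S, E)\<close> is a
  starred standard tableau and \<open>w\<close> is a weakly increasing word that increases strictly at the
  ascents, by \<open>T = w \<circ> S\<close>: cells with equal entry in \<open>T\<close> form a horizontal strip, the absence of
  ascents of kind (a) inside a block forces \<open>S\<close> to number the strip from left to right, and the
  absence of ascents of kind (b) says that no cell of \<open>E\<close> has its entry repeated in the column to
  its left. For special cells of \<open>T\<close> the weights computed in \<open>T\<close> and in \<open>S\<close> agree.
\<close>

section \<open>Compositions\<close>

text \<open>Telescoping: the composition lists the consecutive differences of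
  \<open>0 # ts @ [n]\<close>, so its partial sums run through that list again.\<close>

lemma sum_list_take_differences:
  assumes "sorted ts" and "\<forall>t\<in>set ts. t \<le> (n::nat)" and "i \<le> length ts + 1"
  shows "sum_list (take i (map2 (-) (ts @ [n]) (0 # ts))) = (0 # ts @ [n]) ! i"
  using assms(3)
proof (induction i)
  case (Suc i)
  have s: "sorted (0 # ts @ [n])"
    using assms by (simp add: sorted_append)
  \<comment> \<open>Subtraction on the naturals truncates; the next difference completes the partial
    sum only because the list is increasing.\<close>
  have "(0 # ts @ [n]) ! i \<le> (0 # ts @ [n]) ! Suc i"
    using sorted_nth_mono[OF s, of i "Suc i"] Suc.prems by simp
  moreover have "(0 # ts) ! i = (0 # ts @ [n]) ! i"
    using Suc.prems by (metis Cons_eq_appendI Suc_eq_plus1 Suc_le_lessD length_Cons nth_append)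
  ultimately show ?case
    using Suc by (simp add: take_Suc_conv_app_nth)
qed simp

text \<open>For \<open>n > 0\<close> the partial sums of the composition are 0, the elements of
  \<open>A\<close> in order, and finally \<open>n\<close>. For \<open>n = 0\<close> the composition
  is empty, and so is \<open>A\<close>.\<close>

lemma
  assumes "A \<subseteq> {1..<n}"
  shows sum_list_comp_of_set: "sum_list (comp_of_set n A) = n"
    and sub_of_comp_of_set: "sub_of_comp (comp_of_set n A) = A"
proof -
  define ts where "ts = sorted_list_of_set A"
  have fin: "finite A" using assms finite_subset by blast
  have ts: "sorted ts" "\<forall>t\<in>set ts. t \<le> n" "set ts = A"
    using assms fin by (auto simp: ts_def)
  note take_sum = sum_list_take_differences[OF ts(1,2)]
  have comp: "comp_of_set n A = map2 (-) (ts @ [n]) (0 # ts)" if "n \<noteq> 0"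
    using that by (simp add: comp_of_set_def ts_def Let_def)
  show "sum_list (comp_of_set n A) = n"
  proof (cases "n = 0")
    case False
    then show ?thesis using take_sum[of "length ts + 1"] comp by simp
  qed (simp add: comp_of_set_def)
  show "sub_of_comp (comp_of_set n A) = A"
  proof (cases "n = 0")
    case False
    \<comment> \<open>The bounds on the index cut off both ends of the list, the leading 0 and the
      final \<open>n\<close>, which leaves exactly \<open>ts\<close>.\<close>
    have "sub_of_comp (comp_of_set n A) = (\<lambda>i. (0 # ts @ [n]) ! i) ` {1..<length ts + 1}"
      unfolding sub_of_comp_def comp[OF False] setcompr_eq_image
      using take_sum by (intro image_cong) auto
    also have "\<dots> = (\<lambda>i. (0 # ts @ [n]) ! Suc i) ` {0..<length ts}"
      unfolding image_comp[unfolded comp_def, symmetric] by simp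
    also have "\<dots> = (!) ts ` {0..<length ts}"
      by (intro image_cong) (auto simp: nth_append)
    also have "\<dots> = A" using ts(3) by (auto simp: set_conv_nth)
    finally show ?thesis .
  qed (use assms in \<open>auto simp: comp_of_set_def sub_of_comp_def\<close>)
qed

section \<open>Words indexing the fundamental quasisymmetric polynomials\<close>

definition words_strict_at :: "nat \<Rightarrow> nat \<Rightarrow> nat set \<Rightarrow> (nat \<Rightarrow> nat) set" where
  "words_strict_at n N A =
     {w \<in> {1..n} \<rightarrow>\<^sub>E {1..N}. mono_on {1..n} w \<and> (\<forall>j\<in>A. w j < w (j + 1))}"

lemma finite_words_strict_at: "finite (words_strict_at n N A)"
  by (rule finite_subset[of _ "{1..n} \<rightarrow>\<^sub>E {1..N}"]) (auto simp: words_strict_at_def intro: finite_PiE)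

lemma Asc_subset: "Asc lam mu S \<subseteq> {1..<card (skew_diagram lam mu)}"
  by (auto simp: Asc_def split: prod.splits)

text \<open>Compositions leave the argument here: \<open>sub_of_comp\<close> undoes
  \<open>comp_of_set\<close>, so only the ascent set itself matters from now on.\<close>

lemma fundamental_qsym_Asc_comp:
  "fundamental_qsym N (Asc_comp lam mu S) =
    (\<Sum>w\<in>words_strict_at (card (skew_diagram lam mu)) N (Asc lam mu S).
       \<Prod>j\<in>{1..card (skew_diagram lam mu)}. xvar (w j))"
  unfolding fundamental_qsym_def Asc_comp_def words_strict_at_def
    sum_list_comp_of_set[OF Asc_subset] sub_of_comp_of_set[OF Asc_subset] ..

section \<open>Ranks\<close>

text \<open>Counting with \<le> makes each element count itself, so the ranks start at 1, like the
  entries of a standard tableau.\<close>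

definition rank_on :: "'a set \<Rightarrow> ('a \<Rightarrow> 'b::linorder) \<Rightarrow> 'a \<Rightarrow> nat" where
  "rank_on A f a = card {b \<in> A. f b \<le> f a}"

lemma rank_on_less_iff:
  assumes "finite A" "a \<in> A" "b \<in> A"
  shows "rank_on A f a < rank_on A f b \<longleftrightarrow> f a < f b"
proof -
  have mono: "rank_on A f a \<le> rank_on A f b" if "f a \<le> f b" for a b
    unfolding rank_on_def using assms(1) that by (intro card_mono) auto
  have "rank_on A f a < rank_on A f b" if "f a < f b"
    unfolding rank_on_def
  proof (rule psubset_card_mono)
    show "{c \<in> A. f c \<le> f a} \<subset> {c \<in> A. f c \<le> f b}" using assms that by force
  qed (use assms in auto)
  then show ?thesis using mono[of b a] by (meson leD not_le_imp_less)
qed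

lemma bij_betw_rank_on:
  assumes "finite A" "inj_on f A"
  shows "bij_betw (rank_on A f) A {1..card A}"
proof -
  have inj: "inj_on (rank_on A f) A"
  proof (rule inj_onI)
    fix a b assume ab: "a \<in> A" "b \<in> A" "rank_on A f a = rank_on A f b"
    then have "f a = f b"
      using rank_on_less_iff[OF assms(1), of a b f] rank_on_less_iff[OF assms(1), of b a f]
      by (auto intro: antisym)
    then show "a = b" using ab assms(2) by (auto dest: inj_onD)
  qed
  have "rank_on A f ` A \<subseteq> {1..card A}"
  proof
    fix r assume "r \<in> rank_on A f ` A"
    then obtain a where a: "a \<in> A" "r = rank_on A f a" by auto
    have "rank_on A f a \<le> card A"
      unfolding rank_on_def by (rule card_mono) (use assms in auto)
    moreover have "{b \<in> A. f b \<le> f a} \<noteq> {}" using a by auto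
    then have "rank_on A f a \<noteq> 0" unfolding rank_on_def using assms by simp
    ultimately show "r \<in> {1..card A}" using a by simp
  qed
  moreover have "card (rank_on A f ` A) = card {1..card A}" using card_image[OF inj] by simp
  ultimately show ?thesis using inj by (simp add: bij_betw_def card_subset_eq)
qed

text \<open>A numbering by 1, ..., n is determined by the order it induces: the number of
  \<open>a\<close> counts the elements up to and including \<open>a\<close>. This later identifies a
  given standard tableau as a standardization.\<close>

lemma bij_betw_eq_rank_on:
  assumes "bij_betw s A {1..card A}" "a \<in> A"
    and order: "\<And>b c. b \<in> A \<Longrightarrow> c \<in> A \<Longrightarrow> s b \<le> s c \<longleftrightarrow> f b \<le> f c"
  shows "s a = rank_on A f a"
proof -
  have sa: "s a \<in> {1..card A}" using assms(1,2) by (meson bij_betwE)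
  have "s ` {b \<in> A. f b \<le> f a} = s ` {b \<in> A. s b \<le> s a}" using order assms(2) by auto
  also have "\<dots> = {1..s a}"
  proof
    show "{1..s a} \<subseteq> s ` {b \<in> A. s b \<le> s a}"
    proof
      fix k assume k: "k \<in> {1..s a}"
      then have "k \<in> s ` A" using assms(1) sa by (auto simp: bij_betw_def)
      then show "k \<in> s ` {b \<in> A. s b \<le> s a}" using k by auto
    qed
  qed (use assms(1) in \<open>auto simp: bij_betw_def\<close>)
  finally have "card (s ` {b \<in> A. f b \<le> f a}) = s a" by simp
  moreover have "inj_on s {b \<in> A. f b \<le> f a}"
    using assms(1) by (auto simp: bij_betw_def inj_on_def)
  ultimately show ?thesis by (simp add: rank_on_def card_image)
qed

section \<open>Semistandard tableaux and their standardization\<close>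

lemma finite_skew_diagram: "finite (skew_diagram lam mu)"
proof (rule finite_subset)
  show "skew_diagram lam mu \<subseteq> (\<Union>i\<in>{1..length lam}. {i} \<times> {..part lam i})"
    by (auto simp: skew_diagram_def)
qed auto

lemma finite_SSYT: "finite (SSYT lam mu N)"
  by (rule finite_subset[of _ "skew_diagram lam mu \<rightarrow>\<^sub>E {1..N}"])
    (auto simp: SSYT_def finite_skew_diagram intro!: finite_PiE)

lemma finite_spec: "finite (spec lam mu T)"
  by (rule finite_subset[OF _ finite_skew_diagram]) (auto simp: spec_def)

lemma part_antimono:
  assumes "is_partition lam" "1 \<le> i" "i \<le> i'"
  shows "part lam i' \<le> part lam i"
  using assms sorted_wrt_nth_less[of "(\<ge>)" lam "i - 1" "i' - 1"]
  by (cases "i = i'") (auto simp: part_def is_partition_def)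

text \<open>The cell \<open>(i, j')\<close> lies in the diagram and connects the two cells.\<close>

lemma SSYT_mono:
  assumes "is_partition lam" and T: "T \<in> SSYT lam mu N"
    and c: "(i, j) \<in> skew_diagram lam mu" "(i', j') \<in> skew_diagram lam mu"
    and le: "i \<le> i'" "j \<le> j'"
  shows "T (i, j) \<le> T (i', j')" and "i < i' \<Longrightarrow> T (i, j) < T (i', j')"
proof -
  have d: "(i, j') \<in> skew_diagram lam mu"
    using c le part_antimono[OF assms(1), of i i'] by (auto simp: skew_diagram_def)
  have 1: "T (i, j) \<le> T (i, j')"
    using T c(1) d le by (cases "j = j'") (auto simp: SSYT_def)
  have 2: "T (i, j') < T (i', j')" if "i < i'"
    using T c(2) d that by (auto simp: SSYT_def)
  show "T (i, j) \<le> T (i', j')" using 1 2 le by (cases "i = i'") auto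
  show "T (i, j) < T (i', j')" if "i < i'" using 1 2[OF that] by simp
qed

text \<open>Pairs are compared lexicographically: first by entry, and among equal entries by column
  from left to right.\<close>

definition reading_key :: "tableau \<Rightarrow> cell \<Rightarrow> nat \<times> nat" where
  "reading_key T c = (T c, snd c)"

lemma reading_key_less_iff:
  "reading_key T c < reading_key T c' \<longleftrightarrow> T c < T c' \<or> T c = T c' \<and> snd c < snd c'"
  by (auto simp: reading_key_def)

text \<open>Strictness down columns keeps equal entries in different columns, so the column settles
  every tie.\<close>

lemma inj_on_reading_key:
  assumes "T \<in> SSYT lam mu N"
  shows "inj_on (reading_key T) (skew_diagram lam mu)"
proof (rule inj_onI)
  fix c c' assume c: "c \<in> skew_diagram lam mu" "c' \<in> skew_diagram lam mu"
    and key: "reading_key T c = reading_key T c'"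
  obtain i i' j where [simp]: "c = (i, j)" "c' = (i', j)"
    using key by (cases c, cases c') (auto simp: reading_key_def)
  have "\<not> i < i'" "\<not> i' < i"
    using assms c key by (auto 0 4 simp: SSYT_def reading_key_def dest: less_imp_neq)
  then show "c = c'" by simp
qed

text \<open>The weight uses the tableau only to compare the entry of \<open>c\<close> with entries
  one column to the left; its \<open>mu\<close> part depends on the position of \<open>c\<close>
  alone.\<close>

lemma wt_eq_if_order_eq:
  assumes "\<And>u. (u, snd c - 1) \<in> skew_diagram lam mu \<Longrightarrow>
             S (u, snd c - 1) < S c \<longleftrightarrow> T (u, snd c - 1) < T c"
  shows "wt lam mu S c = wt lam mu T c"
proof -
  obtain i j where [simp]: "c = (i, j)" by fastforce
  have "{(u, v) \<in> skew_diagram lam mu. v = j - 1 \<and> u \<ge> i \<and> S (u, v) < S (i, j)} =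
        {(u, v) \<in> skew_diagram lam mu. v = j - 1 \<and> u \<ge> i \<and> T (u, v) < T (i, j)}"
    using assms by auto
  then show ?thesis by (simp add: wt_def)
qed

definition standardization :: "nat list \<Rightarrow> nat list \<Rightarrow> tableau \<Rightarrow> tableau" where
  "standardization lam mu T =
     restrict (rank_on (skew_diagram lam mu) (reading_key T)) (skew_diagram lam mu)"

lemma standardization_less_iff:
  assumes "c \<in> skew_diagram lam mu" "c' \<in> skew_diagram lam mu"
  shows "standardization lam mu T c < standardization lam mu T c' \<longleftrightarrow>
    T c < T c' \<or> T c = T c' \<and> snd c < snd c'"
  using assms rank_on_less_iff[OF finite_skew_diagram assms, of "reading_key T"]
  by (simp add: standardization_def reading_key_less_iff)

lemma bij_betw_standardization:
  assumes "T \<in> SSYT lam mu N"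
  shows "bij_betw (standardization lam mu T) (skew_diagram lam mu) {1..card (skew_diagram lam mu)}"
  using bij_betw_rank_on[OF finite_skew_diagram inj_on_reading_key[OF assms]]
  by (simp add: standardization_def cong: bij_betw_cong)

text \<open>Along a row a tie is resolved by the larger column, which agrees with the row direction;
  down a column there are no ties.\<close>

lemma standardization_in_SYT:
  assumes T: "T \<in> SSYT lam mu N"
  shows "standardization lam mu T \<in> SYT lam mu"
proof -
  let ?S = "standardization lam mu T"
  note bij = bij_betw_standardization[OF T]
  have "?S \<in> skew_diagram lam mu \<rightarrow>\<^sub>E {1..card (skew_diagram lam mu)}"
    using bij_betwE[OF bij] by (auto simp: standardization_def)
  moreover have "?S (i, j) \<le> ?S (i, j')"
    if "(i, j) \<in> skew_diagram lam mu" "(i, j') \<in> skew_diagram lam mu" "j < j'" for i j j'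
  proof -
    have "T (i, j) \<le> T (i, j')" using T that by (auto simp: SSYT_def)
    then show ?thesis using standardization_less_iff[OF that(1,2), of T] that(3) by auto
  qed
  moreover have "?S (i, j) < ?S (i', j)"
    if "(i, j) \<in> skew_diagram lam mu" "(i', j) \<in> skew_diagram lam mu" "i < i'" for i i' j
  proof -
    have "T (i, j) < T (i', j)" using T that by (auto simp: SSYT_def)
    then show ?thesis using standardization_less_iff[OF that(1,2), of T] by auto
  qed
  ultimately have "?S \<in> SSYT lam mu (card (skew_diagram lam mu))"
    unfolding SSYT_def by blast
  then show ?thesis using bij by (simp add: SYT_def)
qed

section \<open>The correspondence\<close>

text \<open>The index set of the right-hand side once each fundamental polynomial is written as a
  sum over words.\<close>

definition starred_words :: "nat list \<Rightarrow> nat list \<Rightarrow> nat \<Rightarrow> (starred_tableau \<times> (nat \<Rightarrow> nat)) set" where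
  "starred_words lam mu N = (SIGMA P : SYT_star lam mu.
     words_strict_at (card (skew_diagram lam mu)) N (Asc lam mu P))"

definition destandardize ::
    "nat list \<Rightarrow> nat list \<Rightarrow> starred_tableau \<times> (nat \<Rightarrow> nat) \<Rightarrow> starred_tableau" where
  "destandardize lam mu = (\<lambda>((S, E), w). (restrict (w \<circ> S) (skew_diagram lam mu), E))"

text \<open>The word lists the entries of \<open>T\<close> in the order given by the
  standardization: \<open>inv_into\<close> finds the cell numbered \<open>k\<close>.\<close>

definition restandardize ::
    "nat list \<Rightarrow> nat list \<Rightarrow> starred_tableau \<Rightarrow> starred_tableau \<times> (nat \<Rightarrow> nat)" where
  "restandardize lam mu = (\<lambda>(T, E). ((standardization lam mu T, E),
     restrict (T \<circ> inv_into (skew_diagram lam mu) (standardization lam mu T))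
       {1..card (skew_diagram lam mu)}))"

text \<open>The heart of the correspondence: \<open>w \<circ> S\<close> with ties broken by column
  retains the whole order of \<open>S\<close>. Where \<open>w\<close> is constant there are no
  ascents, and this forces \<open>S\<close> to move strictly to the right.\<close>

lemma SYT_less_iff:
  assumes lam: "is_partition lam" and S: "S \<in> SYT lam mu"
    and w: "w \<in> words_strict_at (card (skew_diagram lam mu)) N (Asc lam mu (S, E))"
    and c: "c \<in> skew_diagram lam mu" "c' \<in> skew_diagram lam mu"
  shows "S c < S c' \<longleftrightarrow> w (S c) < w (S c') \<or> w (S c) = w (S c') \<and> snd c < snd c'"
proof -
  let ?D = "skew_diagram lam mu"
  let ?n = "card ?D"
  have bij: "bij_betw S ?D {1..?n}" and SS: "S \<in> SSYT lam mu ?n"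
    using S by (auto simp: SYT_def)
  have mono: "mono_on {1..?n} w" and strict: "\<And>k. k \<in> Asc lam mu (S, E) \<Longrightarrow> w k < w (k + 1)"
    using w by (auto simp: words_strict_at_def)
  define cl where "cl = inv_into ?D S"
  have cl: "cl k \<in> ?D" "S (cl k) = k" if "k \<in> {1..?n}" for k
    using bij that unfolding cl_def
    by (auto simp: bij_betw_def intro: inv_into_into f_inv_into_f)
  have clS: "cl (S c) = c" if "c \<in> ?D" for c
    using bij that unfolding cl_def by (simp add: bij_betw_def)
  have range: "S c \<in> {1..?n}" if "c \<in> ?D" for c using bij that by (meson bij_betwE)
  \<comment> \<open>Without an ascent of kind (a), \<open>k + 1\<close> is not in a lower row than
    \<open>k\<close>. Were it also weakly to the left, monotonicity of \<open>S\<close> would give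
    \<open>k + 1 \<le> k\<close>.\<close>
  have step: "snd (cl k) < snd (cl (Suc k))"
    if k: "1 \<le> k" "Suc k \<le> ?n" and eq: "w k = w (Suc k)" for k
  proof -
    obtain i j i' j' where ij: "cl k = (i, j)" "cl (Suc k) = (i', j')" by fastforce
    have D: "(i, j) \<in> ?D" "(i', j') \<in> ?D" "S (i, j) = k" "S (i', j') = Suc k"
      using cl[of k] cl[of "Suc k"] k ij by auto
    have "k \<notin> Asc lam mu (S, E)" using strict[of k] eq by auto
    then have "\<not> i < i'"
      using D k unfolding Asc_def by auto
    then have "\<not> j' \<le> j"
      using SSYT_mono(1)[OF lam SS D(2,1)] D(3,4) by auto
    then show ?thesis using ij by simp
  qed
  \<comment> \<open>A monotone word with equal values at both ends is constant in between, so the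
    single steps chain.\<close>
  have block: "snd (cl a) < snd (cl b)" if "a < b" "1 \<le> a" "b \<le> ?n" "w a = w b" for a b
    using that
  proof (induction b)
    case (Suc b)
    have "w a \<le> w b" "w b \<le> w (Suc b)"
      using Suc.prems mono_onD[OF mono, of a b] mono_onD[OF mono, of b "Suc b"] by auto
    then have eq: "w a = w b" "w b = w (Suc b)" using Suc.prems by auto
    have st: "snd (cl b) < snd (cl (Suc b))" using step[of b] eq Suc.prems by auto
    show ?case
    proof (cases "a = b")
      case False
      then show ?thesis using Suc eq st by (meson Suc_leD less_SucE order_less_trans)
    qed (use st in simp)
  qed simp
  have fwd: "w (S c) < w (S c') \<or> w (S c) = w (S c') \<and> snd c < snd c'"
    if "S c < S c'" "c \<in> ?D" "c' \<in> ?D" for c c'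
  proof -
    have "w (S c) \<le> w (S c')"
      using mono_onD[OF mono, of "S c" "S c'"] range that by simp
    moreover have "snd c < snd c'" if "w (S c) = w (S c')"
      using block[of "S c" "S c'"] clS range \<open>S c < S c'\<close> \<open>c \<in> ?D\<close> \<open>c' \<in> ?D\<close> that by simp
    ultimately show ?thesis by linarith
  qed
  \<comment> \<open>The right-hand side is a strict order, so the forward implication for both
    orders of the two cells gives the converse.\<close>
  show ?thesis
    using fwd[of c c'] fwd[of c' c] c clS[of c] clS[of c'] by (metis linorder_less_linear order_less_asym)
qed

text \<open>All four claims rest on the order of \<open>S\<close> being the reading order of
  \<open>T\<close>; the ascents of kind (b) enter only to keep the cells of \<open>E\<close> special
  in \<open>T\<close>.\<close>

lemma destandardize_properties:
  assumes lam: "is_partition lam" and P: "((S, E), w) \<in> starred_words lam mu N"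
    and T: "destandardize lam mu ((S, E), w) = (T, E')"
  shows "T \<in> SSYT lam mu N" and "E' \<subseteq> spec lam mu T"
    and "\<And>c. c \<in> E' \<Longrightarrow> wt lam mu S c = wt lam mu T c"
    and "restandardize lam mu (T, E') = ((S, E), w)"
proof -
  let ?D = "skew_diagram lam mu"
  let ?n = "card ?D"
  have S: "S \<in> SYT lam mu" and E: "E \<subseteq> spec lam mu S"
    and w: "w \<in> words_strict_at ?n N (Asc lam mu (S, E))"
    using P by (auto simp: starred_words_def SYT_star_def)
  have bij: "bij_betw S ?D {1..?n}" and SS: "S \<in> SSYT lam mu ?n"
    using S by (auto simp: SYT_def)
  have range: "S c \<in> {1..?n}" if "c \<in> ?D" for c using bij that by (meson bij_betwE)
  have wE: "w \<in> {1..?n} \<rightarrow>\<^sub>E {1..N}" and mono: "mono_on {1..?n} w"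
    and strict: "\<And>k. k \<in> Asc lam mu (S, E) \<Longrightarrow> w k < w (k + 1)"
    using w by (auto simp: words_strict_at_def)
  have [simp]: "E' = E" and T_def: "T = restrict (w \<circ> S) ?D"
    using T by (auto simp: destandardize_def)
  have Tc: "T c = w (S c)" if "c \<in> ?D" for c using that by (simp add: T_def)
  have less_iff: "S c < S c' \<longleftrightarrow> T c < T c' \<or> T c = T c' \<and> snd c < snd c'"
    if "c \<in> ?D" "c' \<in> ?D" for c c'
    using SYT_less_iff[OF lam S w that] that by (simp add: Tc)
  have T_mono: "T c \<le> T c'" if "c \<in> ?D" "c' \<in> ?D" "S c \<le> S c'" for c c'
    using that mono_onD[OF mono, of "S c" "S c'"] range by (simp add: Tc)
  have "T \<in> ?D \<rightarrow>\<^sub>E {1..N}"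
    using wE range unfolding T_def by (auto simp: PiE_iff)
  moreover have "T (i, j) \<le> T (i, j')" if "(i, j) \<in> ?D" "(i, j') \<in> ?D" "j < j'" for i j j'
    using SS that by (intro T_mono) (auto simp: SSYT_def)
  \<comment> \<open>Within one column the tie-break cannot apply, so a strict increase of
    \<open>S\<close> must come from \<open>T\<close>.\<close>
  moreover have "T (i, j) < T (i', j)" if "(i, j) \<in> ?D" "(i', j) \<in> ?D" "i < i'" for i i' j
  proof -
    have "S (i, j) < S (i', j)" using SS that by (auto simp: SSYT_def)
    then show ?thesis using less_iff[OF that(1,2)] by simp
  qed
  ultimately show "T \<in> SSYT lam mu N" unfolding SSYT_def by blast
  show spec: "E' \<subseteq> spec lam mu T"
  proof
    fix c assume "c \<in> E'"
    then have cE: "c \<in> E" by simp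
    obtain i j where [simp]: "c = (i, j)" by fastforce
    have ij: "(i, j) \<in> ?D" "j > 1" using cE E by (auto simp: spec_def)
    have False if u: "(u, j - 1) \<in> ?D" "T (u, j - 1) = T (i, j)" for u
    proof -
      let ?k = "S (u, j - 1)"
      have lt: "?k < S (i, j)" using less_iff[OF u(1) ij(1)] u ij by simp
      \<comment> \<open>A cell numbered strictly between the two would share their
        \<open>T\<close>-entry and lie in a column strictly between \<open>j - 1\<close> and
        \<open>j\<close>. Hence the numbers are adjacent and \<open>?k\<close> is an ascent of kind
        (b), where \<open>w\<close> must increase.\<close>
      have succ: "S (i, j) = ?k + 1"
      proof (rule ccontr)
        assume ne: "S (i, j) \<noteq> ?k + 1"
        have "?k + 1 \<in> {1..?n}" using lt range[OF ij(1)] by simp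
        then obtain d where d: "d \<in> ?D" "S d = ?k + 1" using bij by (metis bij_betw_iff_bijections)
        have "S (u, j - 1) < S d" "S d < S (i, j)" using d lt ne by auto
        then have "T (u, j - 1) < T d \<or> T (u, j - 1) = T d \<and> j - 1 < snd d"
          and "T d < T (i, j) \<or> T d = T (i, j) \<and> snd d < j"
          using less_iff[OF u(1) d(1)] less_iff[OF d(1) ij(1)] by simp_all
        then show False using u(2) by linarith
      qed
      have "?k \<in> {1..<?n}" using lt range[OF ij(1)] range[OF u(1)] by auto
      moreover have "\<exists>u' i' j'. (u', j' - 1) \<in> ?D \<and> (i', j') \<in> ?D \<and>
          S (u', j' - 1) = ?k \<and> S (i', j') = ?k + 1 \<and> (i', j') \<in> E"
        using u(1) ij(1) cE succ \<open>c = (i, j)\<close> by blast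
      ultimately have "?k \<in> Asc lam mu (S, E)"
        unfolding Asc_def by simp
      then show False
        using strict[of ?k] succ u ij by (simp add: Tc)
    qed
    then show "c \<in> spec lam mu T" using ij by (auto simp: spec_def)
  qed
  \<comment> \<open>At a special cell of \<open>T\<close> there is no equality with the column to
    the left, so the comparisons in \<open>S\<close> and in \<open>T\<close> coincide.\<close>
  show "wt lam mu S c = wt lam mu T c" if "c \<in> E'" for c
  proof (rule wt_eq_if_order_eq)
    fix u assume u: "(u, snd c - 1) \<in> ?D"
    have "c \<in> ?D" "T (u, snd c - 1) \<noteq> T c"
      using spec that u by (auto simp: spec_def)
    then show "S (u, snd c - 1) < S c \<longleftrightarrow> T (u, snd c - 1) < T c"
      using less_iff[OF u] by simp
  qed
  \<comment> \<open>Inside the diagram both sides are ranks for the same order; outside it both are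
    \<open>undefined\<close>.\<close>
  have std: "standardization lam mu T = S"
  proof
    fix c
    have "S c = rank_on ?D (reading_key T) c" if "c \<in> ?D"
    proof (rule bij_betw_eq_rank_on[OF bij that])
      fix b d assume "b \<in> ?D" "d \<in> ?D"
      then show "S b \<le> S d \<longleftrightarrow> reading_key T b \<le> reading_key T d"
        using less_iff[of d b] by (simp add: reading_key_less_iff flip: not_less)
    qed
    moreover have "S c = undefined" if "c \<notin> ?D"
      using SS that unfolding SSYT_def by (blast intro: PiE_arb)
    ultimately show "standardization lam mu T c = S c" by (simp add: standardization_def)
  qed
  have "restrict (T \<circ> inv_into ?D S) {1..?n} = w"
  proof
    fix k
    show "restrict (T \<circ> inv_into ?D S) {1..?n} k = w k"
    proof (cases "k \<in> {1..?n}")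
      case True
      then have "inv_into ?D S k \<in> ?D" "S (inv_into ?D S k) = k"
        using bij by (auto simp: bij_betw_def intro: inv_into_into f_inv_into_f)
      then show ?thesis using True by (simp add: Tc)
    next
      case False
      then show ?thesis using wE by (simp add: PiE_iff extensional_def del: atLeastAtMost_iff)
    qed
  qed
  then show "restandardize lam mu (T, E') = ((S, E), w)"
    by (simp add: restandardize_def std)
qed

text \<open>Standardizing numbers equal entries from left to right, so an ascent between equal
  entries would contradict either the strictness of \<open>T\<close> or the specialness of a cell of
  \<open>E\<close>.\<close>

lemma restandardize_properties:
  assumes lam: "is_partition lam" and T: "T \<in> SSYT lam mu N" and E: "E \<subseteq> spec lam mu T"
  shows "restandardize lam mu (T, E) \<in> starred_words lam mu N"
    and "destandardize lam mu (restandardize lam mu (T, E)) = (T, E)"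
proof -
  let ?D = "skew_diagram lam mu"
  let ?n = "card ?D"
  define S where "S = standardization lam mu T"
  define w where "w = restrict (T \<circ> inv_into ?D S) {1..?n}"
  have re: "restandardize lam mu (T, E) = ((S, E), w)"
    by (simp add: restandardize_def S_def w_def)
  have bij: "bij_betw S ?D {1..?n}" unfolding S_def by (rule bij_betw_standardization[OF T])
  have SYT: "S \<in> SYT lam mu" unfolding S_def by (rule standardization_in_SYT[OF T])
  have range: "S c \<in> {1..?n}" if "c \<in> ?D" for c using bij that by (meson bij_betwE)
  have less_iff: "S c < S c' \<longleftrightarrow> T c < T c' \<or> T c = T c' \<and> snd c < snd c'"
    if "c \<in> ?D" "c' \<in> ?D" for c c'
    unfolding S_def by (rule standardization_less_iff[OF that])
  have wS: "w (S c) = T c" if "c \<in> ?D" for c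
    using range[OF that] bij that by (simp add: w_def bij_betw_def)
  have cell: "\<exists>c\<in>?D. S c = k" if "k \<in> {1..?n}" for k
    using bij that by (metis bij_betw_iff_bijections)
  have T_range: "T \<in> ?D \<rightarrow>\<^sub>E {1..N}" using T by (simp add: SSYT_def)
  have "w \<in> {1..?n} \<rightarrow>\<^sub>E {1..N}"
  proof (rule PiE_I)
    fix k assume "k \<in> {1..?n}"
    then obtain c where "c \<in> ?D" "S c = k" using cell by blast
    then show "w k \<in> {1..N}" using wS[of c] PiE_mem[OF T_range, of c] by simp
  qed (simp only: w_def restrict_apply if_False)
  moreover have "mono_on {1..?n} w"
  proof (rule mono_onI)
    fix k l assume "k \<in> {1..?n}" "l \<in> {1..?n}" "k \<le> l"
    then obtain c d where cd: "c \<in> ?D" "S c = k" "d \<in> ?D" "S d = l" using cell by blast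
    then have "\<not> S d < S c" using \<open>k \<le> l\<close> by simp
    then have "T c \<le> T d" using less_iff[OF cd(3,1)] by linarith
    then show "w k \<le> w l" using wS[OF cd(1)] wS[OF cd(3)] cd(2,4) by simp
  qed
  moreover have "w k < w (k + 1)" if k: "k \<in> Asc lam mu (S, E)" for k
  proof -
    \<comment> \<open>Both kinds of ascent at once. If the entries were equal, \<open>d\<close>
      would lie strictly to the right of \<open>c\<close>: a lower row then forces a strict increase
      of \<open>T\<close>, while kind (b) puts the entry of the special cell \<open>d\<close> into
      the column to its left.\<close>
    have lt: "T c < T d" if c: "c \<in> ?D" "d \<in> ?D" "S c = k" "S d = k + 1"
      and asc: "fst c < fst d \<or> snd c = snd d - 1 \<and> d \<in> E" for c d
    proof (rule ccontr)
      assume "\<not> T c < T d"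
      then have eq: "T c = T d" "snd c < snd d" using less_iff[OF c(1,2)] c(3,4) by auto
      obtain i j i' j' where [simp]: "c = (i, j)" "d = (i', j')" by fastforce
      have "\<not> i < i'"
        using SSYT_mono(2)[OF lam T, of i j i' j'] eq c by auto
      then have "j = j' - 1" "d \<in> spec lam mu T" using asc E by auto
      then show False using eq c by (auto simp: spec_def)
    qed
    obtain c d where cd: "c \<in> ?D" "d \<in> ?D" "S c = k" "S d = k + 1" "T c < T d"
      using k lt unfolding Asc_def by fastforce
    then show ?thesis using wS[OF cd(1)] wS[OF cd(2)] by simp
  qed
  ultimately have "w \<in> words_strict_at ?n N (Asc lam mu (S, E))"
    by (simp add: words_strict_at_def)
  \<comment> \<open>Since \<open>S\<close> is injective, every cell outside column 1 is special in
    it.\<close>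
  moreover have "E \<subseteq> spec lam mu S"
  proof
    fix c assume "c \<in> E"
    obtain i j where [simp]: "c = (i, j)" by fastforce
    have ij: "(i, j) \<in> ?D" "j > 1" using E \<open>c \<in> E\<close> by (auto simp: spec_def)
    have "S (u, j - 1) \<noteq> S (i, j)" if "(u, j - 1) \<in> ?D" for u
      using inj_on_eq_iff[OF bij_betw_imp_inj_on[OF bij] that ij(1)] ij(2) by auto
    then show "c \<in> spec lam mu S" using ij by (auto simp: spec_def)
  qed
  ultimately show "restandardize lam mu (T, E) \<in> starred_words lam mu N"
    using SYT by (simp add: re starred_words_def SYT_star_def)
  have "restrict (w \<circ> S) ?D = T"
  proof
    fix c show "restrict (w \<circ> S) ?D c = T c"
      using wS[of c] PiE_arb[OF T_range, of c] by simp
  qed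
  then show "destandardize lam mu (restandardize lam mu (T, E)) = (T, E)"
    by (simp add: re destandardize_def)
qed

section \<open>Expansion over special cells and the final summation\<close>

lemma prod_one_minus_expand:
  fixes f :: "'a \<Rightarrow> 'b::comm_ring_1"
  assumes "finite A"
  shows "(\<Prod>a\<in>A. 1 - f a) = (\<Sum>E\<in>Pow A. (- 1) ^ card E * (\<Prod>a\<in>E. f a))"
  using assms
proof (induction A)
  case (insert a A)
  \<comment> \<open>The subsets of \<open>insert a A\<close> split by whether they contain
    \<open>a\<close>; those that do are the image of \<open>Pow A\<close> and carry the extra factor
    \<open>- f a\<close>.\<close>
  have inj: "inj_on (insert a) (Pow A)"
    using insert.hyps by (auto simp: inj_on_def)
  have "(\<Sum>E\<in>insert a ` Pow A. (- 1) ^ card E * prod f E) =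
        (\<Sum>E\<in>Pow A. - f a * ((- 1) ^ card E * prod f E))"
    unfolding sum.reindex[OF inj]
  proof (rule sum.cong)
    fix E assume "E \<in> Pow A"
    then have "finite E" "a \<notin> E" using insert.hyps finite_subset by auto
    then show "((\<lambda>E. (- 1) ^ card E * prod f E) \<circ> insert a) E = - f a * ((- 1) ^ card E * prod f E)"
      by simp
  qed simp
  then have "(\<Sum>E\<in>Pow (insert a A). (- 1) ^ card E * prod f E) =
        (1 - f a) * (\<Sum>E\<in>Pow A. (- 1) ^ card E * prod f E)"
    unfolding Pow_insert using insert.hyps
    by (subst sum.union_disjoint) (auto simp: sum_distrib_left[symmetric] algebra_simps sum_negf)
  then show ?case using insert by simp
qed simp

theorem theorem4p1:
  fixes lam mu :: "nat list" and n N :: nat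
  assumes "is_partition lam" and "is_partition mu" and "part_contained mu lam"
    and "card (skew_diagram lam mu) = n" and "N \<ge> n"
  shows "skew_HL_poly lam mu N =
    (\<Sum>S\<in>SYT_star lam mu. star_sgn S * tvar ^ tstat lam mu S * fundamental_qsym N (Asc_comp lam mu S))"
proof -
  let ?D = "skew_diagram lam mu"
  define starred where "starred = (SIGMA T : SSYT lam mu N. Pow (spec lam mu T))"
  define x :: "tableau \<Rightarrow> mpol" where "x = (\<lambda>T. \<Prod>c\<in>?D. xvar (T c))"
  define y :: "(nat \<Rightarrow> nat) \<Rightarrow> mpol" where "y = (\<lambda>w. \<Prod>j\<in>{1..card ?D}. xvar (w j))"
  \<comment> \<open>\<open>star_sgn\<close> and \<open>tstat\<close> are defined for any tableau
    with a set of cells, so the same \<open>g\<close> serves for semistandard pairs and for starred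
    standard tableaux.\<close>
  define g where "g = (\<lambda>P. star_sgn P * tvar ^ tstat lam mu P)"
  have fin: "finite (SYT_star lam mu)"
    by (rule finite_subset[of _ "SIGMA S : SSYT lam mu (card ?D). Pow (spec lam mu S)"])
      (auto simp: SYT_star_def SYT_def finite_SSYT finite_spec)
  have "skew_HL_poly lam mu N = (\<Sum>T\<in>SSYT lam mu N. \<Sum>E\<in>Pow (spec lam mu T). g (T, E) * x T)"
    unfolding skew_HL_poly_def prod_one_minus_expand[OF finite_spec] g_def x_def
    by (simp add: sum_distrib_right star_sgn_def tstat_def power_sum)
  also have "\<dots> = (\<Sum>(T, E)\<in>starred. g (T, E) * x T)"
    unfolding starred_def by (rule sum.Sigma) (auto simp: finite_SSYT finite_spec)
  also have "\<dots> = (\<Sum>(P, w)\<in>starred_words lam mu N. g P * y w)"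
  proof (rule sym, rule sum.reindex_bij_witness[where i = "restandardize lam mu" and j = "destandardize lam mu"])
    fix Q assume Q: "Q \<in> starred_words lam mu N"
    obtain S E w where Q_eq: "Q = ((S, E), w)" by (metis surj_pair)
    obtain T where T: "destandardize lam mu ((S, E), w) = (T, E)"
      by (simp add: destandardize_def)
    note props = destandardize_properties[OF assms(1) Q[unfolded Q_eq] T]
    show "restandardize lam mu (destandardize lam mu Q) = Q" using props(4) T Q_eq by simp
    show "destandardize lam mu Q \<in> starred" using props(1,2) T Q_eq by (simp add: starred_def)
    have bij: "bij_betw S ?D {1..card ?D}"
      using Q Q_eq by (auto simp: starred_words_def SYT_star_def SYT_def)
    \<comment> \<open>The product over positions of the word becomes a product over cells by
      reindexing along the bijection \<open>S\<close>.\<close>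
    have "x T = y w"
      unfolding y_def prod.reindex_bij_betw[OF bij, symmetric] x_def
      using T by (auto simp: destandardize_def intro!: prod.cong)
    moreover have "sum (wt lam mu S) E = sum (wt lam mu T) E"
      by (rule sum.cong[OF refl props(3)])
    then have "g (S, E) = g (T, E)"
      by (simp add: g_def star_sgn_def tstat_def)
    ultimately show "(case destandardize lam mu Q of (T, E) \<Rightarrow> g (T, E) * x T) =
        (case Q of (P, w) \<Rightarrow> g P * y w)"
      using T Q_eq by simp
  next
    fix Q assume "Q \<in> starred"
    then obtain T E where "Q = (T, E)" "T \<in> SSYT lam mu N" "E \<subseteq> spec lam mu T"
      by (auto simp: starred_def)
    then show "destandardize lam mu (restandardize lam mu Q) = Q"
      and "restandardize lam mu Q \<in> starred_words lam mu N"
      using restandardize_properties[OF assms(1)] by auto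
  qed
  also have "\<dots> = (\<Sum>P\<in>SYT_star lam mu. \<Sum>w\<in>words_strict_at (card ?D) N (Asc lam mu P). g P * y w)"
    unfolding starred_words_def by (rule sum.Sigma[symmetric]) (auto simp: fin finite_words_strict_at)
  also have "\<dots> = (\<Sum>S\<in>SYT_star lam mu.
      star_sgn S * tvar ^ tstat lam mu S * fundamental_qsym N (Asc_comp lam mu S))"
    by (simp add: fundamental_qsym_Asc_comp sum_distrib_left g_def y_def)
  finally show ?thesis .
qed

end
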